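(* Let $\mathcal{G}$ be a generalized Cops and Robbers game with finite set of positions $\mathcal{P}$. The Pursuer has a winning strategy in $\mathcal{G}$ if and only if there exists $p_P \in \mathcal{I}_P$ such that, for all $q_E \in \mathcal{I}_E(p_P)$, either $(p_P, q_E) \in \mathcal{F}$ or there exists $w_P \in \mathcal{A}_P(p_P, q_E)$ such that $q_E \preceq w_P$.
   Context: A generalized Cops and Robbers game $\mathcal{G}$ is a discrete-time, perfect-information process with two players, the Pursuer ($P$) and the Evader ($E$), given by the following data and rules. (1) There are sets $\mathcal{P}_P$ and $\mathcal{P}_E$ of allowed positions for the Pursuer and the Evader. The set of positions of the game is the subset $\mathcal{P} \subseteq \mathcal{P}_P \times \mathcal{P}_E$ of pairs that can be achieved when moves are made according to the rules. The set of states is the subset $\mathcal{S} \subseteq \mathcal{P} \times \{P,E\}$ of those $((p_P,q_E),Z)$ such that the position $(p_P,q_E)$ with player $Z$ next to move can be achieved when moves are made according to the rules. It is assumed that $\mathcal{P}$ is finite. (2) For each state $((p_P,q_E),P)\in\mathcal{S}$ there is a non-empty set $\mathcal{A}_P(p_P,q_E)\subseteq \mathcal{P}_P$ of allowed moves for the Pursuer: choosing $w_P\in \mathcal{A}_P(p_P,q_E)$ changes the state to $((w_P,q_E),E)$. For each state $((p_P,q_E),E)\in\mathcal{S}$ there is a non-empty set $\mathcal{A}_E(p_P,q_E)\subseteq \mathcal{P}_E$ of allowed moves for the Evader: choosing $x_E\in \mathcal{A}_E(p_P,q_E)$ changes the state to $((p_P,x_E),P)$. (3) There is a set $\mathcal{I}\subseteq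 \mathcal{P}_P\times\mathcal{P}_E$ of allowed start positions. Put $\mathcal{I}_P=\{p_P : (p_P,q_E)\in\mathcal{I} \text{ for some } q_E\in\mathcal{P}_E\}$ and, for $p_P\in\mathcal{P}_P$, $\mathcal{I}_E(p_P)=\{q_E\in\mathcal{P}_E : (p_P,q_E)\in\mathcal{I}\}$. The game begins with the Pursuer choosing $p_P\in\mathcal{I}_P$, and then the Evader choosing $q_E\in\mathcal{I}_E(p_P)$. Thereafter the players move alternately, the Pursuer moving first, each choosing an allowed move given the current state. (4) There is a set $\mathcal{F}$ of final positions (pairs in $\mathcal{P}_P\times\mathcal{P}_E$). The Pursuer wins if at any time-step the current position belongs to $\mathcal{F}$; the Evader wins if the current position never belongs to $\mathcal{F}$. The Pursuer has a winning strategy if he can choose his start position and his subsequent moves (depending on the play so far) so that he wins regardless of the Evader's choices. Relations $\preceq_i$ ($i=0,1,2,\dots$) from $\mathcal{P}_E$ to $\mathcal{P}_P$ are defined recursively: (a) $q_E\preceq_0 p_P$ if and only if $(p_P,q_E)\in\mathcal{F}$. (b) For $i\ge 1$, $q_E\preceq_i p_P$ if and only if $(p_P,q_E)\in\mathcal{F}$, or $((p_P,q_E),E)\in\mathcal{S}$ and for every $x_E\in\mathcal{A}_E(p_P,q_E)$ either $(p_P,x_E)\in\mathcal{F}$ or there exists $w_P\in\mathcal{A}_P(p_P,x_E)$ such that $x_E\preceq_j w_P$ for some $j<i$. Each $\preceq_i$ contains $\preceq_{i-1}$, and by finiteness there is $t$ with $\preceq_t\,=\,\preceq_k$ for all $k\ge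 t$; define $\preceq\,=\,\preceq_t$. *)

theory Defs
  imports Main
begin

datatype player = Pursuer | Evader

type_synonym ('p, 'e) state = "('p \<times> 'e) \<times> player"

(* The values of the two move functions matter only at states (reachable configurations). *)
record ('p, 'e) cr_game =
  pursuer_places :: "'p set"
  evader_places :: "'e set"
  pursuer_moves :: "'p \<Rightarrow> 'e \<Rightarrow> 'p set"
  evader_moves :: "'p \<Rightarrow> 'e \<Rightarrow> 'e set"
  start :: "('p \<times> 'e) set"
  final :: "('p \<times> 'e) set"

definition pursuer_starts :: "('p, 'e) cr_game \<Rightarrow> 'p set" where
  "pursuer_starts G = {p. \<exists>q \<in> evader_places G. (p, q) \<in> start G}"

definition evader_starts :: "('p, 'e) cr_game \<Rightarrow> 'p \<Rightarrow> 'e set" where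
  "evader_starts G p = {q \<in> evader_places G. (p, q) \<in> start G}"

inductive step :: "('p, 'e) cr_game \<Rightarrow> ('p, 'e) state \<Rightarrow> ('p, 'e) state \<Rightarrow> bool"
  for G where
  pursuer_step: "w \<in> pursuer_moves G p q \<Longrightarrow> step G ((p, q), Pursuer) ((w, q), Evader)"
| evader_step: "x \<in> evader_moves G p q \<Longrightarrow> step G ((p, q), Evader) ((p, x), Pursuer)"

definition start_states :: "('p, 'e) cr_game \<Rightarrow> ('p, 'e) state set" where
  "start_states G = start G \<times> {Pursuer}"

(* Reaching a final position decides the winner but does not stop the process, so states
   occurring after a final position count as achievable. *)
definition states :: "('p, 'e) cr_game \<Rightarrow> ('p, 'e) state set" where
  "states G = {s. \<exists>s\<^sub>0 \<in> start_states G. (step G)\<^sup>*\<^sup>* s\<^sub>0 s}"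

definition positions :: "('p, 'e) cr_game \<Rightarrow> ('p \<times> 'e) set" where
  "positions G = fst ` states G"

(* Finiteness of the set of positions is kept as a separate hypothesis. *)
definition generalized_cr_game :: "('p, 'e) cr_game \<Rightarrow> bool" where
  "generalized_cr_game G \<longleftrightarrow>
     start G \<subseteq> pursuer_places G \<times> evader_places G \<and>
     final G \<subseteq> pursuer_places G \<times> evader_places G \<and>
     (\<forall>p q. ((p, q), Pursuer) \<in> states G \<longrightarrow>
        pursuer_moves G p q \<noteq> {} \<and> pursuer_moves G p q \<subseteq> pursuer_places G) \<and>
     (\<forall>p q. ((p, q), Evader) \<in> states G \<longrightarrow>
        evader_moves G p q \<noteq> {} \<and> evader_moves G p q \<subseteq> evader_places G)"

definition play :: "('p, 'e) cr_game \<Rightarrow> (nat \<Rightarrow> ('p, 'e) state) \<Rightarrow> bool" where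
  "play G s \<longleftrightarrow> s 0 \<in> start_states G \<and> (\<forall>n. step G (s n) (s (Suc n)))"

definition histories :: "('p, 'e) cr_game \<Rightarrow> ('p, 'e) state list set" where
  "histories G = {h. h \<noteq> [] \<and> hd h \<in> start_states G \<and> successively (step G) h}"

(* A strategy must prescribe an allowed move after every history with the Pursuer to move.
   Otherwise a strategy prescribing illegal moves would be consistent with no play and
   would win vacuously. *)
definition pursuer_strategy :: "('p, 'e) cr_game \<Rightarrow> (('p, 'e) state list \<Rightarrow> 'p) \<Rightarrow> bool" where
  "pursuer_strategy G \<sigma> \<longleftrightarrow>
     (\<forall>h \<in> histories G. \<forall>p q. last h = ((p, q), Pursuer) \<longrightarrow> \<sigma> h \<in> pursuer_moves G p q)"

definition consistent ::
    "'p \<Rightarrow> (('p, 'e) state list \<Rightarrow> 'p) \<Rightarrow> (nat \<Rightarrow> ('p, 'e) state) \<Rightarrow> bool" where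
  "consistent p\<^sub>0 \<sigma> s \<longleftrightarrow>
     fst (fst (s 0)) = p\<^sub>0 \<and>
     (\<forall>n. snd (s n) = Pursuer \<longrightarrow> fst (fst (s (Suc n))) = \<sigma> (map s [0..<Suc n]))"

definition pursuer_wins :: "('p, 'e) cr_game \<Rightarrow> (nat \<Rightarrow> ('p, 'e) state) \<Rightarrow> bool" where
  "pursuer_wins G s \<longleftrightarrow> (\<exists>n. fst (s n) \<in> final G)"

definition pursuer_has_winning_strategy :: "('p, 'e) cr_game \<Rightarrow> bool" where
  "pursuer_has_winning_strategy G \<longleftrightarrow>
     (\<exists>p\<^sub>0 \<in> pursuer_starts G. \<exists>\<sigma>. pursuer_strategy G \<sigma> \<and>
        (\<forall>s. play G s \<and> consistent p\<^sub>0 \<sigma> s \<longrightarrow> pursuer_wins G s))"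

fun preceq_at :: "('p, 'e) cr_game \<Rightarrow> nat \<Rightarrow> 'e \<Rightarrow> 'p \<Rightarrow> bool" where
  "preceq_at G 0 q p \<longleftrightarrow> (p, q) \<in> final G"
| "preceq_at G (Suc i) q p \<longleftrightarrow>
     (p, q) \<in> final G \<or>
     (((p, q), Evader) \<in> states G \<and>
      (\<forall>x \<in> evader_moves G p q.
         (p, x) \<in> final G \<or>
         (\<exists>w \<in> pursuer_moves G p x. \<exists>j \<in> {..<Suc i}. preceq_at G j x w)))"

definition preceq :: "('p, 'e) cr_game \<Rightarrow> 'e \<Rightarrow> 'p \<Rightarrow> bool" where
  "preceq G = preceq_at G (LEAST t. \<forall>k \<ge> t. preceq_at G k = preceq_at G t)"

lemma preceq_at_mono:
  assumes "preceq_at G i q p" and "i \<le> k"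
  shows "preceq_at G k q p"
proof (cases "(p, q) \<in> final G")
  case True
  then show ?thesis by (cases k) simp_all
next
  case False
  with assms(1) obtain i' where i: "i = Suc i'" by (cases i) simp_all
  with assms(2) obtain k' where k: "k = Suc k'" by (cases k) simp_all
  have sub: "{..<Suc i'} \<subseteq> {..<Suc k'}" using assms(2) i k by simp
  have D: "((p, q), Evader) \<in> states G \<and> (\<forall>x \<in> evader_moves G p q. (p, x) \<in> final G \<or>
      (\<exists>w \<in> pursuer_moves G p x. \<exists>j \<in> {..<Suc i'}. preceq_at G j x w))"
    using assms(1) unfolding i preceq_at.simps(2)
    by (rule disjE) (erule notE[OF False], assumption)
  show ?thesis
    unfolding k preceq_at.simps(2)
  proof (rule disjI2, rule conjI, rule conjunct1[OF D], rule ballI)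
    fix x assume "x \<in> evader_moves G p q"
    with D have "(p, x) \<in> final G \<or>
      (\<exists>w \<in> pursuer_moves G p x. \<exists>j \<in> {..<Suc i'}. preceq_at G j x w)"
      by (elim conjE) (rule bspec)
    then show "(p, x) \<in> final G \<or>
      (\<exists>w \<in> pursuer_moves G p x. \<exists>j \<in> {..<Suc k'}. preceq_at G j x w)"
      by (rule disj_forward) (assumption, elim bexE, intro bexI, assumption, rule subsetD[OF sub])
  qed
qed

lemma preceq_at_cases:
  assumes "preceq_at G i q p"
  shows "(p, q) \<in> final G \<or> (p, q) \<in> positions G"
proof (cases i)
  case 0
  with assms show ?thesis by simp
next
  case (Suc i')
  from assms have "(p, q) \<in> final G \<or> ((p, q), Evader) \<in> states G"
    unfolding Suc preceq_at.simps(2) by (elim disj_forward conjE)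
  then show ?thesis
    unfolding positions_def by (metis fst_conv image_eqI)
qed

(* The LEAST in the definition of preceq is attained. *)
lemma preceq_at_stabilizes:
  assumes "finite (positions G)"
  shows "\<exists>t. \<forall>k \<ge> t. preceq_at G k = preceq_at G t"
proof -
  define B where "B i = {z \<in> positions G. preceq_at G i (snd z) (fst z)}" for i
  have fin: "finite (B i)" and le: "card (B i) \<le> card (positions G)" for i
    using assms by (auto simp: B_def intro: card_mono)
  obtain t where t: "\<And>i. card (B i) \<le> card (B t)"
    using ex_has_greatest_nat[of "\<lambda>_. True" 0 "\<lambda>i. card (B i)" "Suc (card (positions G))"] le
    by (auto simp: le_imp_less_Suc)
  have "preceq_at G k = preceq_at G t" if "t \<le> k" for k
  proof -
    have "B t \<subseteq> B k" using that by (auto simp: B_def intro: preceq_at_mono)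
    then have eq: "B t = B k" using card_seteq[OF fin _ t] by blast
    have "preceq_at G k q p \<longleftrightarrow> preceq_at G t q p" for q p
    proof
      assume k: "preceq_at G k q p"
      show "preceq_at G t q p"
      proof (cases "(p, q) \<in> final G")
        case True
        then show ?thesis by (cases t) auto
      next
        case False
        then have "(p, q) \<in> B k" using k preceq_at_cases[OF k] by (auto simp: B_def)
        then have "(p, q) \<in> B t" using eq by simp
        then show ?thesis by (simp add: B_def)
      qed
    qed (rule preceq_at_mono[OF _ that])
    then show ?thesis by blast
  qed
  then show ?thesis by blast
qed

end

theory Submission imports Defs begin

text \<open>
  The relation \<open>preceq\<close> holds exactly when some \<open>preceq_at\<close> does, and a witnessing index bounds
  the number of further rounds the Pursuer needs.

  If the right-hand side holds, the Pursuer always moves to a place whose index against the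
  Evader's current place is as small as possible. This choice looks only at the current
  position, yet it makes the index drop after every exchange of moves, so a final position is
  reached (\<open>optimal_play_wins\<close>).

  If the right-hand side fails, the Evader keeps the play outside the Pursuer's winning region
  (\<open>winning_state\<close>). By the fixed-point equation \<open>preceq_unfold\<close>, an achievable
  state outside the region with the Evader to move has a successor outside it, while one with
  the Pursuer to move has only such successors. Against any strategy, even one depending on the
  whole history, this builds an infinite play that avoids all final positions
  (\<open>evader_escapes\<close>).
\<close>

section \<open>The limit relation\<close>

lemma preceq_iff_preceq_at:
  assumes "finite (positions G)"
  shows "preceq G q p \<longleftrightarrow> (\<exists>i. preceq_at G i q p)"
proof
  assume "\<exists>i. preceq_at G i q p"
  then obtain i where i: "preceq_at G i q p" ..
  define t where "t = (LEAST t. \<forall>k\<ge>t. preceq_at G k = preceq_at G t)"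
  have "\<forall>k\<ge>t. preceq_at G k = preceq_at G t"
    unfolding t_def using preceq_at_stabilizes[OF assms] by (rule LeastI_ex)
  moreover have "preceq_at G (max i t) q p"
    using i by (rule preceq_at_mono) simp
  ultimately have "preceq_at G t q p"
    by (metis max.cobounded2)
  then show "preceq G q p" by (simp add: preceq_def t_def)
qed (auto simp: preceq_def)

text \<open>
  In the right-to-left direction the replies to different Evader moves may come with different,
  a priori unbounded indices; the stabilization index \<open>t\<close> serves for all of them, so \<open>Suc t\<close>
  serves for \<open>(p, q)\<close>.
\<close>
lemma preceq_unfold:
  assumes "finite (positions G)"
  shows "preceq G q p \<longleftrightarrow>
    (p, q) \<in> final G \<or>
    ((p, q), Evader) \<in> states G \<and>
    (\<forall>x \<in> evader_moves G p q.
       (p, x) \<in> final G \<or> (\<exists>w \<in> pursuer_moves G p x. preceq G x w))"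
    (is "_ \<longleftrightarrow> ?R")
proof
  assume "preceq G q p"
  then obtain i where "preceq_at G i q p"
    using preceq_iff_preceq_at[OF assms] by blast
  then show ?R
    using preceq_iff_preceq_at[OF assms] by (cases i) (simp, auto)
next
  assume R: ?R
  define t where "t = (LEAST t. \<forall>k\<ge>t. preceq_at G k = preceq_at G t)"
  have "preceq G = preceq_at G t" by (simp add: preceq_def t_def)
  with R have "preceq_at G (Suc t) q p" by auto
  then show "preceq G q p"
    using preceq_iff_preceq_at[OF assms] by blast
qed

section \<open>Histories\<close>

lemma history_singleton: "s \<in> start_states G \<Longrightarrow> [s] \<in> histories G"
  by (simp add: histories_def)

lemma history_snoc:
  "h \<in> histories G \<Longrightarrow> step G (last h) s \<Longrightarrow> h @ [s] \<in> histories G"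
  by (auto simp: histories_def successively_append_iff)

lemma last_history_in_states:
  assumes "h \<in> histories G"
  shows "last h \<in> states G"
proof -
  have "h \<noteq> [] \<Longrightarrow> successively (step G) h \<Longrightarrow> (step G)\<^sup>*\<^sup>* (hd h) (last h)"
  proof (induction h rule: rev_nonempty_induct)
    case (snoc s h)
    then show ?case
      by (auto simp: successively_append_iff intro: rtranclp.rtrancl_into_rtrancl)
  qed simp
  with assms show ?thesis
    by (auto simp: histories_def states_def)
qed

section \<open>The Pursuer's optimal strategy\<close>

text \<open>
  Minimality of the index is phrased as domination of all alternatives at every index. Where no
  alternative has an index the condition is void, so that the choice remains a legal move.
\<close>
definition optimal_move :: "('p, 'e) cr_game \<Rightarrow> 'p \<Rightarrow> 'e \<Rightarrow> 'p" where
  "optimal_move G p q =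
     (SOME w. w \<in> pursuer_moves G p q \<and>
        (\<forall>v \<in> pursuer_moves G p q. \<forall>i. preceq_at G i q v \<longrightarrow> preceq_at G i q w))"

lemma optimal_move:
  assumes "pursuer_moves G p q \<noteq> {}"
  shows optimal_move_legal: "optimal_move G p q \<in> pursuer_moves G p q"
    and optimal_move_dominates: "v \<in> pursuer_moves G p q \<Longrightarrow> preceq_at G i q v
          \<Longrightarrow> preceq_at G i q (optimal_move G p q)"
proof -
  let ?M = "pursuer_moves G p q"
  let ?opt = "\<lambda>w. w \<in> ?M \<and> (\<forall>v \<in> ?M. \<forall>i. preceq_at G i q v \<longrightarrow> preceq_at G i q w)"
  have "\<exists>w. ?opt w"
  proof (cases "\<exists>i. \<exists>v \<in> ?M. preceq_at G i q v")
    case True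
    define m where "m = (LEAST i. \<exists>v \<in> ?M. preceq_at G i q v)"
    obtain w where "w \<in> ?M" "preceq_at G m q w"
      using LeastI_ex[OF True] unfolding m_def by blast
    moreover have "m \<le> i" if "v \<in> ?M" "preceq_at G i q v" for v i
      using that unfolding m_def by (blast intro: Least_le)
    ultimately show ?thesis by (blast intro: preceq_at_mono)
  next
    case False
    with assms show ?thesis by blast
  qed
  then have "?opt (optimal_move G p q)"
    unfolding optimal_move_def by (rule someI_ex)
  then show "optimal_move G p q \<in> ?M"
    and "v \<in> ?M \<Longrightarrow> preceq_at G i q v \<Longrightarrow> preceq_at G i q (optimal_move G p q)"
    by blast+
qed

definition optimal_strategy :: "('p, 'e) cr_game \<Rightarrow> ('p, 'e) state list \<Rightarrow> 'p" where
  "optimal_strategy G h = optimal_move G (fst (fst (last h))) (snd (fst (last h)))"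

lemma pursuer_strategy_optimal:
  assumes "generalized_cr_game G"
  shows "pursuer_strategy G (optimal_strategy G)"
  unfolding pursuer_strategy_def
proof (intro ballI allI impI)
  fix h p q
  assume "h \<in> histories G" and h: "last h = ((p, q), Pursuer)"
  then have "((p, q), Pursuer) \<in> states G"
    using last_history_in_states by metis
  then have "pursuer_moves G p q \<noteq> {}"
    using assms by (auto simp: generalized_cr_game_def)
  then show "optimal_strategy G h \<in> pursuer_moves G p q"
    using optimal_move_legal h by (simp add: optimal_strategy_def)
qed

lemma optimal_successor:
  assumes "play G s" and "consistent p\<^sub>0 (optimal_strategy G) s"
    and "s n = ((p, q), Pursuer)"
  shows "s (Suc n) = ((optimal_move G p q, q), Evader)"
proof -
  have "step G ((p, q), Pursuer) (s (Suc n))"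
    using assms(1,3) unfolding play_def by metis
  moreover have "fst (fst (s (Suc n))) = optimal_move G p q"
    using assms(2,3) by (auto simp: consistent_def optimal_strategy_def)
  ultimately show ?thesis by (auto elim: step.cases)
qed

text \<open>
  One exchange of moves strictly decreases the index: the definition of \<open>preceq_at\<close> offers the
  Pursuer a reply of smaller index to every Evader move, and the optimal reply is at least as
  good as the one offered.
\<close>
lemma optimal_play_wins:
  assumes "play G s" and "consistent p\<^sub>0 (optimal_strategy G) s"
    and "s n = ((p, q), Evader)" and "preceq_at G i q p"
  shows "pursuer_wins G s"
  using assms(3,4)
proof (induction i arbitrary: n p q rule: less_induct)
  case (less i)
  show ?case
  proof (cases "(p, q) \<in> final G")
    case True
    with less.prems(1) show ?thesis
      unfolding pursuer_wins_def by (metis fst_conv)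
  next
    case False
    then obtain i' where i: "i = Suc i'"
      using less.prems(2) by (cases i) simp_all
    have "step G ((p, q), Evader) (s (Suc n))"
      using assms(1) less.prems(1) unfolding play_def by metis
    then obtain x where x: "x \<in> evader_moves G p q" and sx: "s (Suc n) = ((p, x), Pursuer)"
      by (auto elim: step.cases)
    show ?thesis
    proof (cases "(p, x) \<in> final G")
      case True
      with sx show ?thesis
        unfolding pursuer_wins_def by (metis fst_conv)
    next
      case False
      then obtain w j where w: "w \<in> pursuer_moves G p x" and j: "j < i" "preceq_at G j x w"
        using less.prems(2) \<open>(p, q) \<notin> final G\<close> x unfolding i preceq_at.simps(2) by blast
      have "preceq_at G j x (optimal_move G p x)"
        using optimal_move_dominates w j(2) by (metis empty_iff)
      with j(1) optimal_successor[OF assms(1,2) sx] show ?thesis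
        by (rule less.IH)
    qed
  qed
qed

section \<open>The Evader's escape\<close>

fun winning_state :: "('p, 'e) cr_game \<Rightarrow> ('p, 'e) state \<Rightarrow> bool" where
  "winning_state G ((p, q), Pursuer) \<longleftrightarrow>
     (p, q) \<in> final G \<or> (\<exists>w \<in> pursuer_moves G p q. preceq G q w)"
| "winning_state G ((p, q), Evader) \<longleftrightarrow> preceq G q p"

lemma winning_state_if_final:
  assumes "finite (positions G)" and "fst s \<in> final G"
  shows "winning_state G s"
proof -
  have "preceq G q p" if "(p, q) \<in> final G" for p q
    using that preceq_unfold[OF assms(1)] by blast
  with assms(2) show ?thesis
    by (cases "(G, s)" rule: winning_state.cases) simp_all
qed

lemma losing_state_has_losing_successor:
  assumes "finite (positions G)" and "pursuer_strategy G \<sigma>"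
    and "h \<in> histories G" and "\<not> winning_state G (last h)"
  shows "\<exists>s. step G (last h) s \<and> \<not> winning_state G s \<and>
    (snd (last h) = Pursuer \<longrightarrow> fst (fst s) = \<sigma> h)"
proof -
  obtain p q z where last: "last h = ((p, q), z)" by (metis surj_pair)
  show ?thesis
  proof (cases z)
    case Pursuer
    have "\<sigma> h \<in> pursuer_moves G p q"
      using assms(2,3) last Pursuer by (auto simp: pursuer_strategy_def)
    then have "step G (last h) ((\<sigma> h, q), Evader)" "\<not> winning_state G ((\<sigma> h, q), Evader)"
      using assms(4) by (auto simp: last Pursuer intro: pursuer_step)
    then show ?thesis by (metis fst_conv)
  next
    case Evader
    have "((p, q), Evader) \<in> states G"
      using last_history_in_states[OF assms(3)] by (simp add: last Evader)
    moreover have "\<not> preceq G q p"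
      using assms(4) by (simp add: last Evader)
    ultimately obtain x where "x \<in> evader_moves G p q" "\<not> winning_state G ((p, x), Pursuer)"
      unfolding winning_state.simps using preceq_unfold[OF assms(1)] by blast
    then show ?thesis
      by (intro exI[of _ "((p, x), Pursuer)"]) (simp add: last Evader evader_step)
  qed
qed

text \<open>
  A strategy may consult the whole past, so the escaping play is built as a sequence of
  histories, each extending the previous one by a single state.
\<close>
lemma evader_escapes:
  assumes fin: "finite (positions G)" and strat: "pursuer_strategy G \<sigma>"
    and start: "s\<^sub>0 \<in> start_states G" and losing: "\<not> winning_state G s\<^sub>0"
  shows "\<exists>s. play G s \<and> consistent (fst (fst s\<^sub>0)) \<sigma> s \<and> \<not> pursuer_wins G s"
proof -
  let ?P = "\<lambda>n h. h \<in> histories G \<and> \<not> winning_state G (last h) \<and> (n = 0 \<longrightarrow> h = [s\<^sub>0])"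
  let ?Q = "\<lambda>(n::nat) h h'. \<exists>s. h' = h @ [s] \<and> step G (last h) s \<and>
    (snd (last h) = Pursuer \<longrightarrow> fst (fst s) = \<sigma> h)"
  have "\<exists>h. ?P 0 h"
    using losing history_singleton[OF start] by (intro exI[of _ "[s\<^sub>0]"]) simp
  moreover have "\<exists>h'. ?P (Suc n) h' \<and> ?Q n h h'" if "?P n h" for n h
    using losing_state_has_losing_successor[OF fin strat, of h] that history_snoc by fastforce
  ultimately obtain H where P: "\<And>n. ?P n (H n)" and Q: "\<And>n. ?Q n (H n) (H (Suc n))"
    using dependent_nat_choice[of ?P ?Q] by blast
  define s where "s n = last (H n)" for n
  have H_Suc: "H (Suc n) = H n @ [s (Suc n)]" for n
    using Q[of n] by (auto simp: s_def)
  have s0: "s 0 = s\<^sub>0" and H0: "H 0 = [s\<^sub>0]"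
    using P[of 0] by (simp_all add: s_def)
  have H_eq: "H n = map s [0..<Suc n]" for n
    by (induction n) (simp_all add: H0 s0 H_Suc)
  have next_s: "step G (s n) (s (Suc n)) \<and>
      (snd (s n) = Pursuer \<longrightarrow> fst (fst (s (Suc n))) = \<sigma> (H n))" for n
    using Q[of n] by (auto simp: s_def)
  have "play G s"
    using next_s start s0 by (simp add: play_def)
  moreover have "consistent (fst (fst s\<^sub>0)) \<sigma> s"
    unfolding consistent_def H_eq[symmetric] using next_s s0 by simp
  moreover have "\<not> pursuer_wins G s"
    unfolding pursuer_wins_def s_def using P winning_state_if_final[OF fin] by blast
  ultimately show ?thesis by blast
qed

section \<open>Characterization of the Pursuer's win\<close>

theorem theorem1:
  fixes G :: "('p, 'e) cr_game"
  assumes "generalized_cr_game G"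
    and "finite (positions G)"
  shows "pursuer_has_winning_strategy G \<longleftrightarrow>
    (\<exists>p \<in> pursuer_starts G. \<forall>q \<in> evader_starts G p.
       (p, q) \<in> final G \<or> (\<exists>w \<in> pursuer_moves G p q. preceq G q w))"
proof
  assume "pursuer_has_winning_strategy G"
  then obtain p \<sigma> where p: "p \<in> pursuer_starts G" and strat: "pursuer_strategy G \<sigma>"
    and wins: "\<And>s. play G s \<Longrightarrow> consistent p \<sigma> s \<Longrightarrow> pursuer_wins G s"
    unfolding pursuer_has_winning_strategy_def by blast
  have "winning_state G ((p, q), Pursuer)" if "q \<in> evader_starts G p" for q
  proof (rule ccontr)
    assume "\<not> winning_state G ((p, q), Pursuer)"
    moreover have "((p, q), Pursuer) \<in> start_states G"
      using that by (simp add: evader_starts_def start_states_def)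
    ultimately show False
      using evader_escapes[OF assms(2) strat] wins by fastforce
  qed
  with p show "\<exists>p \<in> pursuer_starts G. \<forall>q \<in> evader_starts G p.
      (p, q) \<in> final G \<or> (\<exists>w \<in> pursuer_moves G p q. preceq G q w)"
    by auto
next
  assume "\<exists>p \<in> pursuer_starts G. \<forall>q \<in> evader_starts G p.
      (p, q) \<in> final G \<or> (\<exists>w \<in> pursuer_moves G p q. preceq G q w)"
  then obtain p where p: "p \<in> pursuer_starts G"
    and good: "\<And>q. q \<in> evader_starts G p \<Longrightarrow>
      (p, q) \<in> final G \<or> (\<exists>w \<in> pursuer_moves G p q. preceq G q w)"
    by blast
  have "pursuer_wins G s" if s: "play G s" "consistent p (optimal_strategy G) s" for s
  proof -
    obtain q where s0: "s 0 = ((p, q), Pursuer)" and pq: "(p, q) \<in> start G"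
      using s by (auto simp: play_def start_states_def consistent_def)
    then have "q \<in> evader_starts G p"
      using assms(1) by (auto simp: evader_starts_def generalized_cr_game_def)
    then consider "(p, q) \<in> final G"
      | w i where "w \<in> pursuer_moves G p q" "preceq_at G i q w"
      using good preceq_iff_preceq_at[OF assms(2)] by blast
    then show ?thesis
    proof cases
      case 1
      with s0 show ?thesis
        unfolding pursuer_wins_def by (metis fst_conv)
    next
      case 2
      then have "preceq_at G i q (optimal_move G p q)"
        using optimal_move_dominates by (metis empty_iff)
      with optimal_successor[OF s s0] show ?thesis
        by (rule optimal_play_wins[OF s])
    qed
  qed
  with p pursuer_strategy_optimal[OF assms(1)] show "pursuer_has_winning_strategy G"
    unfolding pursuer_has_winning_strategy_def by blast
qed

end
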